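(* Let $n\ge 3$ with $3\mid n$ and set $\Delta=2n/3$. Then there exists a strong tricentral $2$-tree $G$ on $n$ vertices whose core induces $K_3$, whose tail vertices all have degree in $\{2,3\}$, and whose degree sequence is $\left(\frac{2n}{3},\frac{2n}{3},\frac{2n}{3},2^{(n-3)}\right)$.
   Context: A $2$-tree is a graph obtained from the triangle $K_3$ by repeatedly adding a new vertex adjacent to both endpoints of an existing edge. For $r\in\{1,2,3\}$ and an integer $\Delta\ge 2$, a $2$-tree on $n$ vertices is $r$-central with maximum degree $\Delta$ if $\Delta$ is its maximum degree and exactly $r$ vertices have degree $\Delta$; these $r$ vertices form the core and the other $n-r$ vertices form the tail. It is strong if the core induces $K_r$. "Tricentral" means $3$-central. The notation $2^{(k)}$ means $k$ entries equal to $2$. *)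

theory Defs
  imports "Graph_Theory.Graph_Theory" "HOL-Library.Multiset"
begin

text \<open>
  As in Kuratowski.thy of Graph_Theory, a finite simple undirected graph is a symmetric loop-free
  digraph without parallel arcs (locale pair_graph): an undirected edge is a pair of opposite arcs.
  Hence the degree of a vertex in the undirected sense is its out-degree.
\<close>

inductive two_tree :: "'a pair_pre_digraph \<Rightarrow> bool" where
  triangle: "complete_digraph 3 (with_proj G) \<Longrightarrow> two_tree G"
| attach: "two_tree G \<Longrightarrow> (u, v) \<in> parcs G \<Longrightarrow> w \<notin> pverts G \<Longrightarrow>
    two_tree \<lparr> pverts = insert w (pverts G),
               parcs = parcs G \<union> {(w, u), (u, w), (w, v), (v, w)} \<rparr>"

definition deg :: "'a pair_pre_digraph \<Rightarrow> 'a \<Rightarrow> nat" where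
  "deg G v = out_degree (with_proj G) v"

definition max_degree :: "'a pair_pre_digraph \<Rightarrow> nat" where
  "max_degree G = Max (deg G ` pverts G)"

definition degree_sequence :: "'a pair_pre_digraph \<Rightarrow> nat list" where
  "degree_sequence G = rev (sorted_list_of_multiset (image_mset (deg G) (mset_set (pverts G))))"

definition core :: "'a pair_pre_digraph \<Rightarrow> 'a set" where
  "core G = {v \<in> pverts G. deg G v = max_degree G}"

definition tail_verts :: "'a pair_pre_digraph \<Rightarrow> 'a set" where
  "tail_verts G = pverts G - core G"

definition central_two_tree :: "nat \<Rightarrow> nat \<Rightarrow> nat \<Rightarrow> 'a pair_pre_digraph \<Rightarrow> bool" where
  "central_two_tree r \<Delta> n G \<longleftrightarrow>
     r \<in> {1, 2, 3} \<and> \<Delta> \<ge> 2 \<and> two_tree G \<and> card (pverts G) = n \<and>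
     max_degree G = \<Delta> \<and> card (core G) = r"

definition core_induces_complete :: "nat \<Rightarrow> 'a pair_pre_digraph \<Rightarrow> bool" where
  "core_induces_complete r G \<longleftrightarrow> complete_digraph r (with_proj G \<restriction> core G)"

definition strong_central_two_tree :: "nat \<Rightarrow> nat \<Rightarrow> nat \<Rightarrow> 'a pair_pre_digraph \<Rightarrow> bool" where
  "strong_central_two_tree r \<Delta> n G \<longleftrightarrow>
     central_two_tree r \<Delta> n G \<and> core_induces_complete r G"

lemma two_tree_pair_graph: "two_tree G \<Longrightarrow> pair_graph G"
proof (induction rule: two_tree.induct)
  case (triangle G)
  then show ?case by (simp add: complete_digraph_def pair_graphI_graph)
next
  case (attach G u v w)
  then interpret pair_graph G by simp
  have sym: "(b, a) \<in> parcs G" if "(a, b) \<in> parcs G" for a b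
    using that pair_sym_arcs by (auto simp: symmetric_def dest: symD)
  have verts: "a \<in> pverts G" "b \<in> pverts G" if "(a, b) \<in> parcs G" for a b
    using arc_fst_in_verts[OF that] arc_snd_in_verts[OF that] by simp_all
  have neq: "a \<noteq> b" if "(a, b) \<in> parcs G" for a b
    using pair_no_loops[OF that] by simp
  have "w \<noteq> u" "w \<noteq> v"
    using attach verts by blast+
  then show ?case
    using attach(2) pair_finite_verts pair_finite_arcs
    by unfold_locales (auto simp: symmetric_def intro!: symI dest: sym verts neq)
qed

end

theory Submission
  imports Defs
begin

text \<open>
  Every further vertex is attached to one of the three edges of a fixed triangle, the edges being
  used in rotation. Each of the three edges then carries n/3 - 1 vertices of degree two, so a
  triangle vertex, lying on two of the edges, ends up with degree 2 + 2(n/3 - 1) = 2n/3.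
\<close>

text \<open>The triangle is 0, 1, 2, and the residue mod 3 of a later vertex names the one triangle
  vertex it is not joined to. Among 0, 1, 2 themselves, distinct residues just mean distinct
  vertices, so one symmetric, loop-free formula covers both kinds of edge.\<close>

definition book_graph :: "nat \<Rightarrow> nat pair_pre_digraph" where
  "book_graph N = \<lparr> pverts = {..<N},
     parcs = {(a, b). a < N \<and> b < N \<and> (a < 3 \<or> b < 3) \<and> a mod 3 \<noteq> b mod 3} \<rparr>"

lemma pverts_book_graph [simp]: "pverts (book_graph N) = {..<N}"
  by (simp add: book_graph_def)

lemma parcs_book_graph:
  "(a, b) \<in> parcs (book_graph N) \<longleftrightarrow>
     a < N \<and> b < N \<and> (a < 3 \<or> b < 3) \<and> a mod 3 \<noteq> b mod 3"
  by (simp add: book_graph_def)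

text \<open>Turns the residue condition into an explicit pair of neighbours: the edge to which
  \<open>w\<close> is attached, and hence also the two neighbours counted for a tail degree.\<close>

lemma less_3_mod_neq_iff:
  fixes a w :: nat
  shows "a < 3 \<and> a mod 3 \<noteq> w mod 3 \<longleftrightarrow> a = (w + 1) mod 3 \<or> a = (w + 2) mod 3"
  using mod_less_divisor[of 3 w] by (auto simp: mod_Suc split: if_splits)

lemma add_1_mod_3_neq: "(w + 1) mod 3 \<noteq> (w + 2) mod (3 :: nat)"
  by (simp add: mod_Suc)

lemma two_tree_book_graph:
  assumes "N \<ge> 3"
  shows "two_tree (book_graph N)"
  using assms
proof (induction N rule: dec_induct)
  case base
  show ?case
    by (rule two_tree.triangle) (auto simp: complete_digraph_pair_def parcs_book_graph)
next
  case (step N)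
  let ?u = "(N + 1) mod 3" and ?v = "(N + 2) mod 3"
  have "?u < 3" "?v < 3" by simp_all
  then have uv: "?u < 3" "?v < 3" "?u < N" "?v < N"
    using step.hyps by linarith+
  have neq: "?u mod 3 \<noteq> ?v mod 3"
    unfolding mod_mod_trivial by (rule add_1_mod_3_neq)
  have "(a, b) \<in> parcs (book_graph (Suc N)) \<longleftrightarrow>
      (a, b) \<in> parcs (book_graph N) \<union> {(N, ?u), (?u, N), (N, ?v), (?v, N)}" for a b
  proof -
    \<comment> \<open>The left side is the adjacency condition with one endpoint set to the new
      vertex \<open>N\<close>. Since \<open>N \<ge> 3\<close>, it forces \<open>c < 3\<close>, which
      also excludes a loop at \<open>N\<close>.\<close>
    have nbr: "c < Suc N \<and> (N < 3 \<or> c < 3) \<and> N mod 3 \<noteq> c mod 3 \<longleftrightarrow> c = ?u \<or> c = ?v" for c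
      using less_3_mod_neq_iff[of c N] step.hyps by auto
    consider "a = N" | "b = N" "a \<noteq> N" | "a \<noteq> N" "b \<noteq> N" by blast
    then show ?thesis
    proof cases
      case 1
      then show ?thesis using nbr[of b] uv(3,4) by (auto simp: parcs_book_graph)
    next
      case 2
      then show ?thesis using nbr[of a] uv(3,4) by (auto simp: parcs_book_graph)
    next
      case 3
      then show ?thesis by (auto simp: parcs_book_graph)
    qed
  qed
  then have arcs: "parcs (book_graph (Suc N)) =
      parcs (book_graph N) \<union> {(N, ?u), (?u, N), (N, ?v), (?v, N)}"
    by (intro set_eqI) (simp only: split_paired_all)
  have "book_graph (Suc N) = \<lparr> pverts = insert N (pverts (book_graph N)),
      parcs = parcs (book_graph N) \<union> {(N, ?u), (?u, N), (N, ?v), (?v, N)} \<rparr>"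
    unfolding arcs[symmetric] by (simp add: book_graph_def lessThan_Suc)
  moreover have "(?u, ?v) \<in> parcs (book_graph N)"
    using uv neq by (simp add: parcs_book_graph)
  ultimately show ?case
    using two_tree.attach[OF step.IH] by simp
qed

lemma deg_eq_card: "deg G v = card {u. (v, u) \<in> parcs G}"
proof -
  have "out_arcs (with_proj G) v = Pair v ` {u. (v, u) \<in> parcs G}"
    by (auto simp: out_arcs_def)
  then show ?thesis
    by (simp add: deg_def out_degree_def card_image inj_on_def)
qed

text \<open>Each residue class modulo \<open>k\<close> has exactly \<open>m\<close> members below
  \<open>k * m\<close>, so removing one class leaves \<open>k * m - m\<close>. For
  \<open>k = 3\<close> and \<open>v\<close> in the triangle, what remains is the neighbourhood of
  \<open>v\<close>.\<close>

lemma card_less_mod_neq: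
  fixes m k v :: nat
  assumes "v < k"
  shows "card {u. u < k * m \<and> u mod k \<noteq> v} = (k - 1) * m"
proof -
  have "{u. u < k * m \<and> u mod k = v} = (\<lambda>i. k * i + v) ` {..<m}"
  proof (intro set_eqI iffI)
    fix u assume u: "u \<in> {u. u < k * m \<and> u mod k = v}"
    then have "u div k < m"
      by (simp add: less_mult_imp_div_less mult.commute)
    moreover have "u = k * (u div k) + v"
      using u by (metis (mono_tags) mem_Collect_eq mult_div_mod_eq)
    ultimately show "u \<in> (\<lambda>i. k * i + v) ` {..<m}" by blast
  next
    fix u assume "u \<in> (\<lambda>i. k * i + v) ` {..<m}"
    then obtain i where i: "i < m" "u = k * i + v" by auto
    have "k * i + v < k * Suc i" using assms by simp
    also have "\<dots> \<le> k * m" using i(1) by (intro mult_le_mono2) simp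
    finally show "u \<in> {u. u < k * m \<and> u mod k = v}" using i assms by simp
  qed
  then have "card {u. u < k * m \<and> u mod k = v} = m"
    using assms by (simp add: card_image inj_on_def)
  moreover have "{u. u < k * m \<and> u mod k \<noteq> v} = {..<k * m} - {u. u < k * m \<and> u mod k = v}"
    by auto
  moreover have "finite {u. u < k * m \<and> u mod k = v}" by simp
  ultimately show ?thesis
    by (simp add: card_Diff_subset subset_iff diff_mult_distrib)
qed

lemma deg_book_graph:
  assumes "m \<ge> 1" and "v < 3 * m"
  shows "deg (book_graph (3 * m)) v = (if v < 3 then 2 * m else 2)"
proof (cases "v < 3")
  case True
  \<comment> \<open>A triangle vertex is its own residue, and \<open>v < 3\<close> already satisfies
    the disjunction in the adjacency condition.\<close>
  then have "{u. (v, u) \<in> parcs (book_graph (3 * m))} = {u. u < 3 * m \<and> u mod 3 \<noteq> v}"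
    using assms by (auto simp: parcs_book_graph)
  then show ?thesis
    using True card_less_mod_neq[of v 3 m] by (simp add: deg_eq_card)
next
  case False
  \<comment> \<open>A tail vertex has neighbours only in the triangle, and
    \<open>3 \<le> 3 * m\<close> makes the bound \<open>u < 3 * m\<close> automatic.\<close>
  have "{u. (v, u) \<in> parcs (book_graph (3 * m))} = {u. u < 3 \<and> u mod 3 \<noteq> v mod 3}"
    using assms False by (auto simp: parcs_book_graph)
  also have "\<dots> = {(v + 1) mod 3, (v + 2) mod 3}"
    unfolding less_3_mod_neq_iff by auto
  finally have "deg (book_graph (3 * m)) v = card {(v + 1) mod 3, (v + 2) mod 3}"
    by (simp add: deg_eq_card)
  then show ?thesis
    using False add_1_mod_3_neq[of v] by (simp del: add_2_eq_Suc')
qed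

lemma max_degree_book_graph:
  assumes "m \<ge> 1"
  shows "max_degree (book_graph (3 * m)) = 2 * m"
  unfolding max_degree_def
proof (rule Max_eqI)
  \<comment> \<open>The tail degree 2 stays within the bound because \<open>m \<ge> 1\<close>; the
    triangle vertex 0 attains it.\<close>
  show "d \<le> 2 * m" if "d \<in> deg (book_graph (3 * m)) ` pverts (book_graph (3 * m))" for d
    using that assms by (auto simp: deg_book_graph)
  show "2 * m \<in> deg (book_graph (3 * m)) ` pverts (book_graph (3 * m))"
    using assms by (intro image_eqI[of _ _ 0]) (auto simp: deg_book_graph)
qed simp

text \<open>For m = 1 the tail is empty, so that the degree 2 = 2m is still attained by the core only.\<close>

lemma core_book_graph:
  assumes "m \<ge> 1"
  shows "core (book_graph (3 * m)) = {..<3}"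
  using assms
  by (auto simp: core_def max_degree_book_graph deg_book_graph split: if_splits)

text \<open>Brings the induced core back into the form \<open>with_proj\<close>, to which the
  characterisation \<open>complete_digraph_pair_def\<close> applies.\<close>

lemma with_proj_induce_subgraph:
  "with_proj G \<restriction> S = with_proj \<lparr> pverts = S, parcs = {(a, b) \<in> parcs G. a \<in> S \<and> b \<in> S} \<rparr>"
  by (auto simp: induce_subgraph_def with_proj_def)

lemma core_induces_complete_book_graph:
  assumes "m \<ge> 1"
  shows "core_induces_complete 3 (book_graph (3 * m))"
  using assms
  by (auto simp: core_induces_complete_def core_book_graph with_proj_induce_subgraph
      complete_digraph_pair_def parcs_book_graph)

text \<open>A descending list is determined by its multiset, so it suffices to count how often each
  degree occurs.\<close>

lemma degree_sequence_eqI: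
  assumes "image_mset (deg G) (mset_set (pverts G)) = mset xs" and "sorted (rev xs)"
  shows "degree_sequence G = xs"
proof -
  have "sort xs = rev xs"
    by (rule properties_for_sort) (use assms(2) in auto)
  then show ?thesis
    using assms(1) by (simp add: degree_sequence_def)
qed

lemma degree_sequence_book_graph:
  assumes "m \<ge> 1"
  shows "degree_sequence (book_graph (3 * m)) =
    [2 * m, 2 * m, 2 * m] @ replicate (3 * m - 3) 2"
proof (rule degree_sequence_eqI)
  let ?d = "deg (book_graph (3 * m))"
  have "{..<3 * m} = {..<3} \<union> {3..<3 * m}" using assms by auto
  then have "image_mset ?d (mset_set {..<3 * m}) =
      image_mset ?d (mset_set {..<3}) + image_mset ?d (mset_set {3..<3 * m})"
    by (simp add: mset_set_Union ivl_disj_int)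
  also have "image_mset ?d (mset_set {..<3 :: nat}) = image_mset (\<lambda>_. 2 * m) (mset_set {..<3 :: nat})"
    using assms by (intro image_mset_cong) (simp add: deg_book_graph)
  also have "image_mset ?d (mset_set {3..<3 * m}) = image_mset (\<lambda>_. 2) (mset_set {3..<3 * m})"
    using assms by (intro image_mset_cong) (simp add: deg_book_graph)
  finally show "image_mset ?d (mset_set (pverts (book_graph (3 * m)))) =
      mset ([2 * m, 2 * m, 2 * m] @ replicate (3 * m - 3) 2)"
    by (simp add: image_mset_const_eq numeral_3_eq_3)
  \<comment> \<open>The list descends because \<open>2 \<le> 2 * m\<close>.\<close>
  show "sorted (rev ([2 * m, 2 * m, 2 * m] @ replicate (3 * m - 3) 2))"
    using assms by (auto simp: sorted_append)
qed

theorem theorem5p4: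
  fixes n \<Delta> :: nat
  assumes "n \<ge> 3" and "3 dvd n" and "\<Delta> = 2 * n div 3"
  shows "\<exists>G :: nat pair_pre_digraph.
           strong_central_two_tree 3 \<Delta> n G \<and>
           core_induces_complete 3 G \<and>
           (\<forall>v \<in> tail_verts G. deg G v \<in> {2, 3}) \<and>
           degree_sequence G =
             [2 * n div 3, 2 * n div 3, 2 * n div 3] @ replicate (n - 3) 2"
proof -
  obtain m where n: "n = 3 * m" using assms(2) by blast
  with assms(1) have m: "m \<ge> 1" by simp
  have div: "2 * n div 3 = 2 * m" by (simp add: n)
  let ?G = "book_graph (3 * m)"
  have "central_two_tree 3 \<Delta> n ?G"
    using m div assms(3)
    by (simp add: central_two_tree_def two_tree_book_graph max_degree_book_graph
        core_book_graph n)
  \<comment> \<open>The tail consists of the vertices from 3 on, all of degree 2.\<close>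
  moreover have "\<forall>v \<in> tail_verts ?G. deg ?G v \<in> {2, 3}"
    using m by (simp add: tail_verts_def core_book_graph deg_book_graph)
  ultimately show ?thesis
    using m core_induces_complete_book_graph[OF m] degree_sequence_book_graph[OF m]
    unfolding strong_central_two_tree_def div unfolding n by blast
qed

end
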